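(* Let $(p_n)$ and $(p_n')$ be two sets of orthogonal polynomials with real recurrence coefficients, given by $p_{-1}=p_{-1}'=0$, $p_0=p_0'=1$ and, for $n\ge 0$, $$\alpha_{n+1}p_{n+1}(x)=(x-\beta_n)p_n(x)-\gamma_{n-1}p_{n-1}(x),\qquad \alpha_{n+1}'p_{n+1}'(x)=(x-\beta_n')p_n'(x)-\gamma_{n-1}'p_{n-1}'(x),$$ where $\alpha_{n+1}\gamma_n>0$ and $\alpha_{n+1}'\gamma_n'>0$ for all $n\ge 0$, and put $\alpha_0=0$. Let $L$ be the linear functional on polynomials with $L(1)=1$ and $L(p_ip_j)=0$ for $i\ne j$. Then for all non-negative integers $m,n,k$, $$L(p_mp_np_k')=\frac{\gamma_0\gamma_1\cdots\gamma_{m-1}}{\alpha_1\cdots\alpha_m\,\alpha_1'\cdots\alpha_k'}\sum_{P}v(P),$$ where the sum is over all generalized Motzkin paths $P$ from $(0,m)$ to $(k,n)$, and $v(P)$ is the product over the edges $e$ of $P$ of the weights $v(e)$, where an edge starting at $(i,j)$ has weight $$v(e)=\begin{cases} \beta_j-\beta_i' & \text{if } e \text{ is } H,\\ \gamma_j-\alpha_i' & \text{if } e \text{ is } U \text{ and is preceded by } D,\\ \gamma_j & \text{if } e \text{ is } U \text{ and is not preceded by } D,\\ \alpha_j-\alpha_i' & \text{if } e \text{ is } D \text{ and is preceded by } U,\\ \alpha_j & \text{if } e \text{ is } D \text{ and is not preceded by } U,\\ (\alpha_j+\gamma_j-\alpha_i'-\gamma_i')\,\alpha_{i+1}' & \text{if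 } e \text{ is } HH \text{ and is preceded by } U \text{ or } D,\\ (\alpha_j+\gamma_j-\gamma_i')\,\alpha_{i+1}' & \text{if } e \text{ is } HH \text{ and is not preceded by } U \text{ or } D. \end{cases}$$
   Context: A generalized Motzkin path is a lattice path in the plane, i.e. a finite sequence of edges, all of whose vertices lie at or above the $x$-axis, and each of whose edges is one of four types: $H$ = step $(1,0)$, $U$ = step $(1,1)$, $D$ = step $(1,-1)$, or $HH$ = a single edge with step $(2,0)$. A single $HH$ edge is regarded as different from two consecutive $H$ edges. "Preceded by" refers to the immediately preceding edge in the path (the first edge is not preceded by any edge). The weight of a path with no edges is $1$, and empty products equal $1$. *)

theory Defs
  imports Complex_Main "HOL-Computational_Algebra.Polynomial" "HOL-Library.Product_Plus"
begin

(* The term with p_(-1) = 0 is absent when n = 0, so that no index -1 is needed. *)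
definition orthogonal_recurrence ::
    "(nat \<Rightarrow> real) \<Rightarrow> (nat \<Rightarrow> real) \<Rightarrow> (nat \<Rightarrow> real) \<Rightarrow> (nat \<Rightarrow> real poly) \<Rightarrow> bool"
where
  "orthogonal_recurrence \<alpha> \<beta> \<gamma> p \<longleftrightarrow>
     p 0 = 1 \<and>
     (\<forall>n. smult (\<alpha> (n + 1)) (p (n + 1)) =
          [:- \<beta> n, 1:] * p n - (if n = 0 then 0 else smult (\<gamma> (n - 1)) (p (n - 1))))"

definition linear_functional :: "(real poly \<Rightarrow> real) \<Rightarrow> bool"
where
  "linear_functional L \<longleftrightarrow> Vector_Spaces.linear smult (*) L"

lemma linear_functional_iff:
  "linear_functional L \<longleftrightarrow>
     (\<forall>p q. L (p + q) = L p + L q) \<and> (\<forall>c p. L (smult c p) = c * L p)"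
proof -
  have "vector_space (smult :: real \<Rightarrow> real poly \<Rightarrow> real poly)"
    by unfold_locales (simp_all add: smult_add_left smult_add_right)
  moreover have "vector_space ((*) :: real \<Rightarrow> real \<Rightarrow> real)"
    by unfold_locales (simp_all add: algebra_simps)
  ultimately show ?thesis
    unfolding linear_functional_def Vector_Spaces.linear_iff by auto
qed

datatype edge = H | U | D | HH

fun step :: "edge \<Rightarrow> int \<times> int" where
  "step H = (1, 0)"
| "step U = (1, 1)"
| "step D = (1, -1)"
| "step HH = (2, 0)"

(* A path is its starting point together with its list of edges;
   path_vertex s P l is the vertex reached after the first l edges. *)
definition path_vertex :: "int \<times> int \<Rightarrow> edge list \<Rightarrow> nat \<Rightarrow> int \<times> int"
where
  "path_vertex s P l = s + (\<Sum>r<l. step (P ! r))"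

definition motzkin_paths :: "int \<times> int \<Rightarrow> int \<times> int \<Rightarrow> edge list set"
where
  "motzkin_paths s t =
     {P. (\<forall>l\<le>length P. snd (path_vertex s P l) \<ge> 0) \<and> path_vertex s P (length P) = t}"

definition preceding_edge :: "edge list \<Rightarrow> nat \<Rightarrow> edge option"
where
  "preceding_edge P l = (if l = 0 then None else Some (P ! (l - 1)))"

fun edge_weight ::
    "(nat \<Rightarrow> real) \<Rightarrow> (nat \<Rightarrow> real) \<Rightarrow> (nat \<Rightarrow> real) \<Rightarrow> (nat \<Rightarrow> real) \<Rightarrow> (nat \<Rightarrow> real) \<Rightarrow> (nat \<Rightarrow> real) \<Rightarrow>
     edge option \<Rightarrow> nat \<Rightarrow> nat \<Rightarrow> edge \<Rightarrow> real"
where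
  "edge_weight \<alpha> \<beta> \<gamma> \<alpha>' \<beta>' \<gamma>' e' i j H = \<beta> j - \<beta>' i"
| "edge_weight \<alpha> \<beta> \<gamma> \<alpha>' \<beta>' \<gamma>' e' i j U = (if e' = Some D then \<gamma> j - \<alpha>' i else \<gamma> j)"
| "edge_weight \<alpha> \<beta> \<gamma> \<alpha>' \<beta>' \<gamma>' e' i j D = (if e' = Some U then \<alpha> j - \<alpha>' i else \<alpha> j)"
| "edge_weight \<alpha> \<beta> \<gamma> \<alpha>' \<beta>' \<gamma>' e' i j HH =
     (if e' = Some U \<or> e' = Some D
      then (\<alpha> j + \<gamma> j - \<alpha>' i - \<gamma>' i) * \<alpha>' (i + 1)
      else (\<alpha> j + \<gamma> j - \<gamma>' i) * \<alpha>' (i + 1))"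

(* On paths starting at (0, m) and staying weakly above the x-axis
   all coordinates are nonnegative, so nat does not truncate. *)
definition path_weight ::
    "(nat \<Rightarrow> real) \<Rightarrow> (nat \<Rightarrow> real) \<Rightarrow> (nat \<Rightarrow> real) \<Rightarrow> (nat \<Rightarrow> real) \<Rightarrow> (nat \<Rightarrow> real) \<Rightarrow> (nat \<Rightarrow> real) \<Rightarrow>
     int \<times> int \<Rightarrow> edge list \<Rightarrow> real"
where
  "path_weight \<alpha> \<beta> \<gamma> \<alpha>' \<beta>' \<gamma>' s P =
     (\<Prod>l<length P.
        edge_weight \<alpha> \<beta> \<gamma> \<alpha>' \<beta>' \<gamma>' (preceding_edge P l)
          (nat (fst (path_vertex s P l))) (nat (snd (path_vertex s P l))) (P ! l))"

lemma finite_motzkin_paths: "finite (motzkin_paths s t)"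
proof -
  have ge: "fst (path_vertex s P l) \<ge> fst s + int l" for P l
  proof (induction l)
    case 0
    show ?case by (simp add: path_vertex_def)
  next
    case (Suc l)
    have "fst (step (P ! l)) \<ge> 1" by (cases "P ! l") auto
    then show ?case using Suc by (simp add: path_vertex_def)
  qed
  have univ: "(UNIV :: edge set) = {H, U, D, HH}"
    using edge.exhaust by blast
  have "motzkin_paths s t \<subseteq> {P. set P \<subseteq> UNIV \<and> length P \<le> nat (fst t - fst s)}"
  proof
    fix P assume "P \<in> motzkin_paths s t"
    then have "path_vertex s P (length P) = t" by (simp add: motzkin_paths_def)
    with ge[of "length P" P] show "P \<in> {P. set P \<subseteq> UNIV \<and> length P \<le> nat (fst t - fst s)}"
      by auto
  qed
  moreover have "finite {P :: edge list. set P \<subseteq> UNIV \<and> length P \<le> nat (fst t - fst s)}"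
    by (rule finite_lists_length_le) (simp add: univ)
  ultimately show ?thesis by (rule finite_subset)
qed

end

theory Submission
  imports Defs
begin

text \<open>
  The polynomial \<open>x p\<^sub>m p\<^sub>n p'\<^sub>k\<close> can be expanded by the recurrence of \<open>p\<^sub>n\<close> or by that of
  \<open>p'\<^sub>k\<close>. Comparing the values of \<open>L\<close> on the two expansions shows that the numbers
  \<open>F(k, n) = \<alpha>'\<^sub>1 \<dots> \<alpha>'\<^sub>k L(p\<^sub>m p\<^sub>n p'\<^sub>k)\<close> satisfy
  \<open>F(k + 1, n) = \<alpha>\<^sub>n\<^sub>+\<^sub>1 F(k, n + 1) + (\<beta>\<^sub>n - \<beta>'\<^sub>k) F(k, n) + \<gamma>\<^sub>n\<^sub>-\<^sub>1 F(k, n - 1) - \<gamma>'\<^sub>k\<^sub>-\<^sub>1 \<alpha>'\<^sub>k F(k - 1, n)\<close>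
  (\<open>linearization_recurrence\<close>). Orthogonality makes \<open>F(0, n)\<close> vanish for \<open>n \<noteq> m\<close>, and
  \<open>F(0, m) = L(p\<^sub>m\<^sup>2)\<close> is the quotient of products of \<open>\<gamma>\<close> and \<open>\<alpha>\<close> in the formula
  (\<open>orthogonal_norm\<close>). So it is enough that the path sums \<open>S(k, n)\<close> satisfy the same recurrence
  (\<open>path_sum_recurrence\<close>); in column \<open>0\<close> only the empty path contributes.

  To see this, split the paths by their last edge, and write \<open>S\<^sup>U\<close> and \<open>S\<^sup>D\<close> for the sums over the
  paths that end with \<open>U\<close> and with \<open>D\<close>. The edges \<open>D\<close>, \<open>H\<close>, \<open>U\<close> with their uncorrected weights and
  the part \<open>-\<gamma>'\<^sub>k\<^sub>-\<^sub>1 \<alpha>'\<^sub>k\<close> of the weight of \<open>HH\<close> give the recurrence exactly. What remains is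
  \<open>\<alpha>'\<^sub>k\<close> times
  \<open>(\<alpha>\<^sub>n + \<gamma>\<^sub>n) S(k - 1, n) - \<alpha>'\<^sub>k\<^sub>-\<^sub>1 (S\<^sup>U(k - 1, n) + S\<^sup>D(k - 1, n)) - S\<^sup>U(k, n + 1) - S\<^sup>D(k, n - 1)\<close>:
  the rest of the \<open>HH\<close> edges, and the corrections for the peaks \<open>UD\<close> and the valleys \<open>DU\<close>. It is
  zero, because the definition of the weights gives
  \<open>S\<^sup>U(k, n + 1) = \<gamma>\<^sub>n S(k - 1, n) - \<alpha>'\<^sub>k\<^sub>-\<^sub>1 S\<^sup>D(k - 1, n)\<close> and
  \<open>S\<^sup>D(k, n - 1) = \<alpha>\<^sub>n S(k - 1, n) - \<alpha>'\<^sub>k\<^sub>-\<^sub>1 S\<^sup>U(k - 1, n)\<close>; the latter for \<open>n = 0\<close> because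
  \<open>\<alpha>\<^sub>0 = 0\<close> and no \<open>U\<close> ends on the axis. Thus the edge \<open>HH\<close> is there to cancel the
  peaks and valleys that span the same two columns.
\<close>

section \<open>Removing the last edge of a path\<close>

definition last_edge :: "edge list \<Rightarrow> edge option" where
  "last_edge P = (if P = [] then None else Some (last P))"

lemma path_vertex_append:
  assumes "l \<le> length P"
  shows "path_vertex s (P @ Q) l = path_vertex s P l"
  using assms unfolding path_vertex_def by (auto simp: nth_append intro!: sum.cong)

lemma path_vertex_snoc_end:
  "path_vertex s (P @ [e]) (Suc (length P)) = path_vertex s P (length P) + step e"
proof -
  have "path_vertex s (P @ [e]) (Suc (length P)) = path_vertex s (P @ [e]) (length P) + step e"
    by (simp add: path_vertex_def add.assoc)
  then show ?thesis by (simp add: path_vertex_append)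
qed

lemma Nil_in_motzkin_paths: "[] \<in> motzkin_paths s t \<longleftrightarrow> s = t \<and> 0 \<le> snd s"
  by (auto simp: motzkin_paths_def path_vertex_def)

lemma snoc_in_motzkin_paths:
  "P @ [e] \<in> motzkin_paths s t \<longleftrightarrow> P \<in> motzkin_paths s (t - step e) \<and> 0 \<le> snd t"
proof -
  have "(\<forall>l\<le>Suc (length P). 0 \<le> snd (path_vertex s (P @ [e]) l)) \<longleftrightarrow>
        (\<forall>l\<le>length P. 0 \<le> snd (path_vertex s P l)) \<and>
        0 \<le> snd (path_vertex s P (length P) + step e)"
    by (auto simp: le_Suc_eq path_vertex_append path_vertex_snoc_end simp flip: path_vertex_snoc_end)
  then show ?thesis
    by (auto simp: motzkin_paths_def path_vertex_snoc_end algebra_simps)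
qed

lemma motzkin_paths_below_axis: "snd t < 0 \<Longrightarrow> motzkin_paths s t = {}"
  unfolding motzkin_paths_def by force

lemma motzkin_paths_left_of_start:
  assumes "fst t < fst s"
  shows "motzkin_paths s t = {}"
proof -
  have "fst (step e) \<ge> 0" for e by (cases e) auto
  then have "fst s \<le> fst (path_vertex s P l)" for P l
    by (simp add: path_vertex_def fst_sum sum_nonneg)
  with assms show ?thesis unfolding motzkin_paths_def
    by (metis (mono_tags, lifting) Collect_empty_eq not_le)
qed

lemma motzkin_paths_same_column:
  assumes "fst t = fst s"
  shows "motzkin_paths s t = (if s = t \<and> 0 \<le> snd s then {[]} else {})"
proof -
  have "P = []" if "P \<in> motzkin_paths s t" for P
  proof (cases P rule: rev_cases)
    case (snoc Q e)
    have "fst (t - step e) < fst s" using assms by (cases e) auto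
    with that snoc show ?thesis
      by (simp add: snoc_in_motzkin_paths motzkin_paths_left_of_start)
  qed
  then have "P \<in> motzkin_paths s t \<longleftrightarrow> P = [] \<and> s = t \<and> 0 \<le> snd s" for P
    using Nil_in_motzkin_paths [of s t] by metis
  then show ?thesis by auto
qed

section \<open>The path sum satisfies a three-term recurrence\<close>

context
  fixes \<alpha> \<beta> \<gamma> \<alpha>' \<beta>' \<gamma>' :: "nat \<Rightarrow> real" and s :: "int \<times> int"
begin

private abbreviation (input) weight where
  "weight \<equiv> path_weight \<alpha> \<beta> \<gamma> \<alpha>' \<beta>' \<gamma>' s"

definition path_sum :: "int \<Rightarrow> int \<Rightarrow> real" where
  "path_sum x y = (\<Sum>P\<in>motzkin_paths s (x, y). weight P)"

definition path_sum_ending :: "edge \<Rightarrow> int \<Rightarrow> int \<Rightarrow> real" where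
  "path_sum_ending e x y =
     (\<Sum>P\<in>motzkin_paths s (x, y). if last_edge P = Some e then weight P else 0)"

lemma path_weight_snoc:
  assumes "P \<in> motzkin_paths s (x, y)"
  shows "weight (P @ [e]) =
    weight P * edge_weight \<alpha> \<beta> \<gamma> \<alpha>' \<beta>' \<gamma>' (last_edge P) (nat x) (nat y) e"
proof -
  have "path_vertex s P (length P) = (x, y)"
    using assms by (simp add: motzkin_paths_def)
  moreover have "preceding_edge (P @ [e]) l = preceding_edge P l" if "l < length P" for l
    using that by (auto simp: preceding_edge_def nth_append)
  moreover have "preceding_edge (P @ [e]) (length P) = last_edge P"
    by (auto simp: preceding_edge_def last_edge_def nth_append last_conv_nth)
  ultimately show ?thesis
    by (simp add: path_weight_def path_vertex_append nth_append)
qed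

text \<open>
  Appending the edge is a bijection from the paths to the penultimate vertex; for \<open>y \<ge> 0\<close> the new
  vertex does not violate the condition on the heights.
\<close>

lemma path_sum_ending_eq:
  assumes "0 \<le> y"
  shows "path_sum_ending e x y =
    (\<Sum>P\<in>motzkin_paths s ((x, y) - step e).
       weight P * edge_weight \<alpha> \<beta> \<gamma> \<alpha>' \<beta>' \<gamma>' (last_edge P)
         (nat (fst ((x, y) - step e))) (nat (snd ((x, y) - step e))) e)"
proof -
  let ?M = "motzkin_paths s ((x, y) - step e)"
  have img: "{P \<in> motzkin_paths s (x, y). last_edge P = Some e} = (\<lambda>P. P @ [e]) ` ?M"
  proof (intro equalityI subsetI)
    fix P assume P: "P \<in> {P \<in> motzkin_paths s (x, y). last_edge P = Some e}"
    then have "P = butlast P @ [e]"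
      by (metis (mono_tags, lifting) append_butlast_last_id last_edge_def mem_Collect_eq
          option.distinct(1) option.inject)
    with P show "P \<in> (\<lambda>P. P @ [e]) ` ?M"
      by (metis (mono_tags, lifting) image_eqI mem_Collect_eq snoc_in_motzkin_paths)
  qed (use assms in \<open>auto simp: snoc_in_motzkin_paths last_edge_def\<close>)
  have "path_sum_ending e x y =
      sum weight {P \<in> motzkin_paths s (x, y). last_edge P = Some e}"
    unfolding path_sum_ending_def
    by (rule sum.inter_filter [symmetric]) (rule finite_motzkin_paths)
  also have "\<dots> = (\<Sum>P\<in>?M. weight (P @ [e]))"
    unfolding img by (subst sum.reindex) (auto simp: inj_on_def)
  also have "\<dots> = (\<Sum>P\<in>?M. weight P * edge_weight \<alpha> \<beta> \<gamma> \<alpha>' \<beta>' \<gamma>' (last_edge P)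
         (nat (fst ((x, y) - step e))) (nat (snd ((x, y) - step e))) e)"
    by (intro sum.cong refl path_weight_snoc) (simp only: prod.collapse)
  finally show ?thesis .
qed

lemma path_sum_by_last_edge:
  assumes "x \<noteq> fst s"
  shows "path_sum x y = path_sum_ending H x y + path_sum_ending U x y
    + path_sum_ending D x y + path_sum_ending HH x y"
proof -
  have "weight P = (if last_edge P = Some H then weight P else 0)
      + (if last_edge P = Some U then weight P else 0)
      + (if last_edge P = Some D then weight P else 0)
      + (if last_edge P = Some HH then weight P else 0)"
    if "P \<in> motzkin_paths s (x, y)" for P
  proof -
    have "P \<noteq> []" using that assms by (auto simp: Nil_in_motzkin_paths)
    then show ?thesis by (cases "last P") (auto simp: last_edge_def)
  qed
  then show ?thesis
    unfolding path_sum_def path_sum_ending_def sum.distrib [symmetric] by (rule sum.cong [OF refl])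
qed

lemma path_sum_below_axis: "y < 0 \<Longrightarrow> path_sum x y = 0"
  and path_sum_left_of_start: "x < fst s \<Longrightarrow> path_sum x y = 0"
  by (simp_all add: path_sum_def motzkin_paths_below_axis motzkin_paths_left_of_start)

lemma path_sum_ending_below_axis: "y < 0 \<Longrightarrow> path_sum_ending e x y = 0"
  and path_sum_ending_left_of_start: "x < fst s \<Longrightarrow> path_sum_ending e x y = 0"
  by (simp_all add: path_sum_ending_def motzkin_paths_below_axis motzkin_paths_left_of_start)

lemma path_sum_ending_U_on_axis: "path_sum_ending U x 0 = 0"
  by (simp add: path_sum_ending_eq motzkin_paths_below_axis)

lemma path_sum_ending_H:
  assumes "0 \<le> y"
  shows "path_sum_ending H (x + 1) y = (\<beta> (nat y) - \<beta>' (nat x)) * path_sum x y"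
  using assms by (simp add: path_sum_ending_eq path_sum_def sum_distrib_left mult.commute)

lemma path_sum_ending_U:
  assumes "0 \<le> y"
  shows "path_sum_ending U (x + 1) (y + 1) =
    \<gamma> (nat y) * path_sum x y - \<alpha>' (nat x) * path_sum_ending D x y"
proof -
  have "w * (if b then g - a else g) = g * w - a * (if b then w else 0)"
    for w g a :: real and b by (simp add: algebra_simps)
  then show ?thesis using assms
    by (simp add: path_sum_ending_eq [of "y + 1"] path_sum_def path_sum_ending_def [of D]
        sum_distrib_left sum_subtractf)
qed

lemma path_sum_ending_D:
  assumes "0 < y"
  shows "path_sum_ending D (x + 1) (y - 1) =
    \<alpha> (nat y) * path_sum x y - \<alpha>' (nat x) * path_sum_ending U x y"
proof -
  have "w * (if b then g - a else g) = g * w - a * (if b then w else 0)"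
    for w g a :: real and b by (simp add: algebra_simps)
  then show ?thesis using assms
    by (simp add: path_sum_ending_eq [of "y - 1"] path_sum_def path_sum_ending_def [of U]
        sum_distrib_left sum_subtractf)
qed

lemma path_sum_ending_HH:
  assumes "0 \<le> y"
  shows "path_sum_ending HH (x + 2) y =
    (\<alpha> (nat y) + \<gamma> (nat y) - \<gamma>' (nat x)) * \<alpha>' (nat x + 1) * path_sum x y
    - \<alpha>' (nat x) * \<alpha>' (nat x + 1) * (path_sum_ending U x y + path_sum_ending D x y)"
proof -
  have "w * (if e' = Some U \<or> e' = Some D then (a + g - a0 - g') * a1 else (a + g - g') * a1) =
      (a + g - g') * a1 * w
      - a0 * a1 * ((if e' = Some U then w else 0) + (if e' = Some D then w else 0))"
    for w g a a0 g' a1 :: real and e' by (auto simp: algebra_simps)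
  then show ?thesis using assms
    by (simp add: path_sum_ending_eq [of y HH] path_sum_def path_sum_ending_def [of U]
        path_sum_ending_def [of D] sum_distrib_left sum_subtractf flip: sum.distrib)
qed

text \<open>
  The contribution of \<open>HH\<close> cancels the corrections in the weights of \<open>U\<close> after \<open>D\<close> and of \<open>D\<close> after
  \<open>U\<close>, once the sums over paths ending in \<open>U\<close> or \<open>D\<close> are traced back one more column. A \<open>D\<close> from
  the axis would end below it; there \<open>\<alpha>\<^sub>0 = 0\<close> keeps the formula valid. The terms in which
  \<open>nat\<close> truncates \<open>x - 1\<close> or \<open>y - 1\<close> carry a path sum that vanishes.
\<close>

lemma path_sum_recurrence:
  assumes "\<alpha> 0 = 0" "fst s = 0" "0 \<le> x" "0 \<le> y"
  shows "path_sum (x + 1) y =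
    \<alpha> (nat (y + 1)) * path_sum x (y + 1) + (\<beta> (nat y) - \<beta>' (nat x)) * path_sum x y
    + \<gamma> (nat (y - 1)) * path_sum x (y - 1)
    - \<gamma>' (nat (x - 1)) * \<alpha>' (nat x) * path_sum (x - 1) y"
proof -
  have last: "path_sum (x + 1) y = path_sum_ending H (x + 1) y + path_sum_ending U (x + 1) y
      + path_sum_ending D (x + 1) y + path_sum_ending HH (x + 1) y"
    using assms by (intro path_sum_by_last_edge) simp
  have D: "path_sum_ending D (x + 1) y =
      \<alpha> (nat (y + 1)) * path_sum x (y + 1) - \<alpha>' (nat x) * path_sum_ending U x (y + 1)"
    using path_sum_ending_D [of "y + 1" x] assms by simp
  have U: "path_sum_ending U (x + 1) y =
      \<gamma> (nat (y - 1)) * path_sum x (y - 1) - \<alpha>' (nat x) * path_sum_ending D x (y - 1)"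
  proof (cases "y = 0")
    case True
    then show ?thesis
      by (simp add: path_sum_ending_U_on_axis path_sum_below_axis path_sum_ending_below_axis)
  next
    case False
    then show ?thesis using path_sum_ending_U [of "y - 1" x] assms by simp
  qed
  have U': "path_sum_ending U x (y + 1) =
      \<gamma> (nat y) * path_sum (x - 1) y - \<alpha>' (nat (x - 1)) * path_sum_ending D (x - 1) y"
    using path_sum_ending_U [of y "x - 1"] assms by simp
  have D': "path_sum_ending D x (y - 1) =
      \<alpha> (nat y) * path_sum (x - 1) y - \<alpha>' (nat (x - 1)) * path_sum_ending U (x - 1) y"
  proof (cases "y = 0")
    case True
    then show ?thesis using assms
      by (simp add: path_sum_ending_U_on_axis path_sum_ending_below_axis)
  next
    case False
    then show ?thesis using path_sum_ending_D [of y "x - 1"] assms by simp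
  qed
  (* For x = 0 both sides are zero, since no path ends left of the starting point. *)
  have HH: "path_sum_ending HH (x + 1) y =
      (\<alpha> (nat y) + \<gamma> (nat y) - \<gamma>' (nat (x - 1))) * \<alpha>' (nat x) * path_sum (x - 1) y
      - \<alpha>' (nat (x - 1)) * \<alpha>' (nat x)
        * (path_sum_ending U (x - 1) y + path_sum_ending D (x - 1) y)"
  proof (cases "x = 0")
    case True
    then show ?thesis
      using path_sum_ending_HH [of y "-1"] assms
      by (simp add: path_sum_left_of_start path_sum_ending_left_of_start)
  next
    case False
    then have "nat (x - 1) + 1 = nat x" using assms by simp
    then show ?thesis using path_sum_ending_HH [of y "x - 1"] assms by (simp add: add.commute)
  qed
  show ?thesis
    unfolding last path_sum_ending_H [OF assms(4)] U D U' D' HH by (simp add: algebra_simps)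
qed

lemma path_sum_start_column:
  "path_sum (fst s) y = (if y = snd s \<and> 0 \<le> y then 1 else 0)"
proof -
  have "motzkin_paths s (fst s, y) = (if y = snd s \<and> 0 \<le> y then {[]} else {})"
    using motzkin_paths_same_column [of "(fst s, y)" s] by (cases s) auto
  then show ?thesis by (simp add: path_sum_def path_weight_def)
qed

end

section \<open>The functional satisfies the same recurrence\<close>

lemma orthogonal_recurrence_times_x:
  assumes "orthogonal_recurrence \<alpha> \<beta> \<gamma> p"
  shows "[:0, 1:] * p n = smult (\<alpha> (n + 1)) (p (n + 1)) + smult (\<beta> n) (p n)
    + (if n = 0 then 0 else smult (\<gamma> (n - 1)) (p (n - 1)))"
proof -
  have "smult (\<alpha> (n + 1)) (p (n + 1)) =
      [:- \<beta> n, 1:] * p n - (if n = 0 then 0 else smult (\<gamma> (n - 1)) (p (n - 1)))"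
    using assms by (simp add: orthogonal_recurrence_def)
  then show ?thesis by (simp add: algebra_simps)
qed

lemma
  assumes "linear_functional L"
  shows linear_functional_add: "L (p + q) = L p + L q"
    and linear_functional_smult: "L (smult c p) = c * L p"
    and linear_functional_0: "L 0 = 0"
proof -
  show smult: "L (smult c p) = c * L p" for c p
    using assms by (simp add: linear_functional_iff)
  show "L (p + q) = L p + L q"
    using assms by (simp add: linear_functional_iff)
  show "L 0 = 0" using smult [of 0 0] by simp
qed

text \<open>
  The multiplication by \<open>x\<close> in \<open>L(x p\<^sub>n p\<^sub>n\<^sub>+\<^sub>1)\<close> can be absorbed by either factor, which gives
  \<open>\<alpha>\<^sub>n\<^sub>+\<^sub>1 L(p\<^sub>n\<^sub>+\<^sub>1\<^sup>2) = \<gamma>\<^sub>n L(p\<^sub>n\<^sup>2)\<close>.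
\<close>

lemma orthogonal_norm:
  assumes rec: "orthogonal_recurrence \<alpha> \<beta> \<gamma> p"
    and nz: "\<And>i. \<alpha> (i + 1) \<noteq> 0"
    and L: "linear_functional L" "L 1 = 1"
    and orth: "\<And>i j. i \<noteq> j \<Longrightarrow> L (p i * p j) = 0"
  shows "L (p n * p n) = (\<Prod>i<n. \<gamma> i) / (\<Prod>i=1..n. \<alpha> i)"
proof (induction n)
  case 0
  then show ?case using rec L(2) by (simp add: orthogonal_recurrence_def)
next
  case (Suc n)
  note lin = linear_functional_add [OF L(1)] linear_functional_smult [OF L(1)]
    linear_functional_0 [OF L(1)]
  have "L ([:0, 1:] * p n * p (Suc n)) = \<alpha> (Suc n) * L (p (Suc n) * p (Suc n))"
    unfolding orthogonal_recurrence_times_x [OF rec]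
    by (simp add: lin distrib_right orth)
  moreover have "L (p n * ([:0, 1:] * p (Suc n))) = \<gamma> n * L (p n * p n)"
    unfolding orthogonal_recurrence_times_x [OF rec]
    by (simp add: lin distrib_left orth)
  moreover have "[:0, 1:] * p n * p (Suc n) = p n * ([:0, 1:] * p (Suc n))"
    by (simp only: mult_ac)
  ultimately have "\<alpha> (Suc n) * L (p (Suc n) * p (Suc n)) = \<gamma> n * L (p n * p n)"
    by simp
  then have "L (p (Suc n) * p (Suc n)) = \<gamma> n * L (p n * p n) / \<alpha> (Suc n)"
    using nz [of n] by (simp add: field_simps)
  then show ?case by (simp add: Suc.IH field_simps)
qed

text \<open>
  Both sides come from \<open>L(x f p\<^sub>n p'\<^sub>k)\<close>, with the factor \<open>x\<close> absorbed by \<open>p'\<^sub>k\<close> or by \<open>p\<^sub>n\<close>.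
\<close>

lemma linearization_recurrence:
  assumes rec: "orthogonal_recurrence \<alpha> \<beta> \<gamma> p"
    and rec': "orthogonal_recurrence \<alpha>' \<beta>' \<gamma>' p'"
    and L: "linear_functional L"
  shows "\<alpha>' (k + 1) * L (f * p n * p' (k + 1)) =
    \<alpha> (n + 1) * L (f * p (n + 1) * p' k) + (\<beta> n - \<beta>' k) * L (f * p n * p' k)
    + (if n = 0 then 0 else \<gamma> (n - 1) * L (f * p (n - 1) * p' k))
    - (if k = 0 then 0 else \<gamma>' (k - 1) * L (f * p n * p' (k - 1)))"
proof -
  note lin = linear_functional_add [OF L] linear_functional_smult [OF L] linear_functional_0 [OF L]
  have "L (f * p n * ([:0, 1:] * p' k)) = \<alpha>' (k + 1) * L (f * p n * p' (k + 1))
      + \<beta>' k * L (f * p n * p' k)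
      + (if k = 0 then 0 else \<gamma>' (k - 1) * L (f * p n * p' (k - 1)))"
    unfolding orthogonal_recurrence_times_x [OF rec']
    by (simp add: lin distrib_left)
  moreover have "L (f * ([:0, 1:] * p n) * p' k) = \<alpha> (n + 1) * L (f * p (n + 1) * p' k)
      + \<beta> n * L (f * p n * p' k)
      + (if n = 0 then 0 else \<gamma> (n - 1) * L (f * p (n - 1) * p' k))"
    unfolding orthogonal_recurrence_times_x [OF rec]
    by (simp add: lin distrib_left distrib_right)
  moreover have "f * p n * ([:0, 1:] * p' k) = f * ([:0, 1:] * p n) * p' k"
    by (simp only: mult_ac)
  ultimately show ?thesis by (simp add: algebra_simps)
qed

theorem theorem2:
  fixes \<alpha> \<beta> \<gamma> \<alpha>' \<beta>' \<gamma>' :: "nat \<Rightarrow> real"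
    and p p' :: "nat \<Rightarrow> real poly"
    and L :: "real poly \<Rightarrow> real"
    and m n k :: nat
  assumes "orthogonal_recurrence \<alpha> \<beta> \<gamma> p"
    and "orthogonal_recurrence \<alpha>' \<beta>' \<gamma>' p'"
    and "\<And>i. \<alpha> (i + 1) * \<gamma> i > 0"
    and "\<And>i. \<alpha>' (i + 1) * \<gamma>' i > 0"
    and "\<alpha> 0 = 0"
    and "linear_functional L"
    and "L 1 = 1"
    and "\<And>i j. i \<noteq> j \<Longrightarrow> L (p i * p j) = 0"
  shows "L (p m * p n * p' k) =
    (\<Prod>i<m. \<gamma> i) / ((\<Prod>i=1..m. \<alpha> i) * (\<Prod>i=1..k. \<alpha>' i)) *
    (\<Sum>P\<in>motzkin_paths (0, int m) (int k, int n).
       path_weight \<alpha> \<beta> \<gamma> \<alpha>' \<beta>' \<gamma>' (0, int m) P)"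
proof -
  define S where "S = path_sum \<alpha> \<beta> \<gamma> \<alpha>' \<beta>' \<gamma>' (0, int m)"
  define h where "h = (\<Prod>i<m. \<gamma> i) / (\<Prod>i=1..m. \<alpha> i)"
  define A where "A k = (\<Prod>i=1..k. \<alpha>' i)" for k
  have nz: "\<alpha> (i + 1) \<noteq> 0" "\<alpha>' (i + 1) \<noteq> 0" for i
    using assms(3,4) [of i] by auto
  have A_Suc: "A (Suc k) = \<alpha>' (Suc k) * A k" for k
    by (simp add: A_def)
  have A_nz: "A k \<noteq> 0" for k
    by (induction k) (use nz(2) in \<open>auto simp: A_Suc A_def\<close>)
  have S_rec: "S (int k + 1) (int n) =
      \<alpha> (n + 1) * S (int k) (int (n + 1)) + (\<beta> n - \<beta>' k) * S (int k) (int n)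
      + (if n = 0 then 0 else \<gamma> (n - 1) * S (int k) (int (n - 1)))
      - (if k = 0 then 0 else \<gamma>' (k - 1) * \<alpha>' k * S (int (k - 1)) (int n))" for k n
  proof -
    have "S (int k) (- 1) = 0" "S (- 1) (int n) = 0"
      by (simp_all add: S_def path_sum_below_axis path_sum_left_of_start)
    moreover have "S (int k + 1) (int n) =
        \<alpha> (nat (int n + 1)) * S (int k) (int n + 1)
        + (\<beta> (nat (int n)) - \<beta>' (nat (int k))) * S (int k) (int n)
        + \<gamma> (nat (int n - 1)) * S (int k) (int n - 1)
        - \<gamma>' (nat (int k - 1)) * \<alpha>' (nat (int k)) * S (int k - 1) (int n)"
      unfolding S_def by (rule path_sum_recurrence) (use assms(5) in auto)
    ultimately show ?thesis
      by (cases n; cases k) (simp_all add: nat_add_distrib add.commute)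
  qed
  (* The factor A k makes p' k the monic polynomial, whose recurrence has the coefficient
     \<gamma>' (k - 1) * \<alpha>' k of the path recurrence. *)
  have "A k * L (p m * p n * p' k) = h * S (int k) (int n)" for n
  proof (induction k arbitrary: n rule: less_induct)
    case (less k)
    show ?case
    proof (cases k)
      case 0
      have "p' 0 = 1" using assms(2) by (simp add: orthogonal_recurrence_def)
      moreover have "S 0 (int n) = (if n = m then 1 else 0)"
        using path_sum_start_column [of \<alpha> \<beta> \<gamma> \<alpha>' \<beta>' \<gamma>' "(0, int m)" "int n"]
        by (simp add: S_def)
      moreover have "L (p m * p m) = h"
        unfolding h_def using assms nz(1) by (intro orthogonal_norm) auto
      ultimately show ?thesis using 0 assms(8) [of m n] by (simp add: A_def)
    next
      case (Suc j)
      have IH: "A j * L (p m * p n * p' j) = h * S (int j) (int n)" for n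
        by (rule less.IH) (simp add: Suc)
      have IH': "A j * L (p m * p n * p' (j - 1)) = \<alpha>' j * (h * S (int (j - 1)) (int n))"
        if "j \<noteq> 0"
      proof -
        have "A j = \<alpha>' j * A (j - 1)" using that by (cases j) (simp_all add: A_Suc)
        moreover have "A (j - 1) * L (p m * p n * p' (j - 1)) = h * S (int (j - 1)) (int n)"
          by (rule less.IH) (simp add: Suc)
        ultimately show ?thesis by simp
      qed
      have "A (Suc j) * L (p m * p n * p' (Suc j)) = A j * (\<alpha>' (j + 1) * L (p m * p n * p' (j + 1)))"
        by (simp add: A_Suc)
      also have "\<dots> = \<alpha> (n + 1) * (A j * L (p m * p (n + 1) * p' j))
          + (\<beta> n - \<beta>' j) * (A j * L (p m * p n * p' j))
          + (if n = 0 then 0 else \<gamma> (n - 1) * (A j * L (p m * p (n - 1) * p' j)))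
          - (if j = 0 then 0 else \<gamma>' (j - 1) * (A j * L (p m * p n * p' (j - 1))))"
        unfolding linearization_recurrence [OF assms(1,2,6)] by (simp add: algebra_simps)
      also have "(if j = 0 then 0 else \<gamma>' (j - 1) * (A j * L (p m * p n * p' (j - 1)))) =
          (if j = 0 then 0 else \<gamma>' (j - 1) * (\<alpha>' j * (h * S (int (j - 1)) (int n))))"
        using IH' by simp
      also have "\<alpha> (n + 1) * (A j * L (p m * p (n + 1) * p' j))
          + (\<beta> n - \<beta>' j) * (A j * L (p m * p n * p' j))
          + (if n = 0 then 0 else \<gamma> (n - 1) * (A j * L (p m * p (n - 1) * p' j)))
          - \<dots> = h * S (int j + 1) (int n)"
        unfolding S_rec IH by (simp add: algebra_simps)
      finally show ?thesis using Suc by (simp add: add.commute)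
    qed
  qed
  then have "L (p m * p n * p' k) = h * S (int k) (int n) / A k"
    using A_nz [of k] by (simp add: nonzero_eq_divide_eq mult.commute [of _ "A k"])
  then show ?thesis by (simp add: h_def A_def S_def path_sum_def)
qed

end
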